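(* For a pattern $p$, let $F_p(x,y)=\sum_{n\geq 0}\sum_{k\geq 0}a_{n,k}x^ny^k$, where $a_{n,k}$ is the number of paths in $\mathcal{D}_n^{h,\geq}$ containing exactly $k$ occurrences of $p$. Then $$F_{UUU}(x,y)=\frac{x^3y-x^3-x^2y^2+2x-1+\sqrt{(x-xy-1)(x^2-xy+x-1)(x^3-x^3y+x^2y^2+2x^2y-2xy-2x+1)}}{2x^2y^2(x-1)},$$ $$F_{UUD}(x,y)=\frac{x^2y-2x^2+2x-1+\sqrt{(x^2y-1)(x^2y-4x^2+4x-1)}}{2x^2(x-1)},$$ $$F_{DUU}(x,y)=\frac{2x-x^2y-1+\sqrt{(x^2y-1)(x^2y-4x^2+4x-1)}}{2x^2y(x-1)},$$ $$F_{DUD}(x,y)=\frac{x^3y-x^3-x^2y^2+2xy-1+\sqrt{(xy-x-1)(x^2+yx-x-1)(x^3y-x^3+x^2y^2+2x^2y-2xy-2x+1)}}{2x^2(xy-1)}.$$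
   Context: Dyck paths are lattice paths with steps $U=(1,1)$, $D=(1,-1)$ from $(0,0)$ to $(2n,0)$ never going below the $x$-axis ($n$ is the semilength). Every nonempty Dyck path $P$ has a unique first return decomposition $P=U\alpha D\beta$ with $\alpha,\beta$ Dyck paths. Let $h(P)$ denote the maximal height of a Dyck path. The set $\mathcal{D}^{h,\geq}$ is defined recursively: it contains the empty path, and a nonempty Dyck path $P=U\alpha D\beta$ belongs to $\mathcal{D}^{h,\geq}$ iff $\alpha,\beta\in\mathcal{D}^{h,\geq}$ and $h(U\alpha D)\geq h(\beta)$. $\mathcal{D}_n^{h,\geq}$ is the set of its elements of semilength $n$. An occurrence of a pattern in a path is an occurrence as a sequence of consecutive steps. *)

theory Defs
  imports "HOL-Computational_Algebra.Computational_Algebra"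
begin

section \<open>Dyck paths\<close>

datatype step = U | D

fun rise :: "step \<Rightarrow> int" where
  "rise U = 1"
| "rise D = -1"

definition level :: "step list \<Rightarrow> int" where
  "level P = (\<Sum>s\<leftarrow>P. rise s)"

definition dyck :: "step list \<Rightarrow> bool" where
  "dyck P \<longleftrightarrow> level P = 0 \<and> (\<forall>k\<le>length P. level (take k P) \<ge> 0)"

definition height :: "step list \<Rightarrow> int" where
  "height P = Max ((\<lambda>k. level (take k P)) ` {..length P})"

section \<open>First return decomposition constrained by height\<close>

inductive_set DH :: "step list set" where
  empty: "[] \<in> DH"
| first_return: "dyck \<alpha> \<Longrightarrow> dyck \<beta> \<Longrightarrow> \<alpha> \<in> DH \<Longrightarrow> \<beta> \<in> DH \<Longrightarrow>
    height (U # \<alpha> @ [D]) \<ge> height \<beta> \<Longrightarrow> U # \<alpha> @ D # \<beta> \<in> DH"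

definition DH_n :: "nat \<Rightarrow> step list set" where
  "DH_n n = {P \<in> DH. length P = 2 * n}"

lemma level_simps [simp]:
  "level [] = 0" "level (s # P) = rise s + level P" "level (P @ Q) = level P + level Q"
  by (simp_all add: level_def)

lemma dyck_Nil [simp]: "dyck []"
  by (simp add: dyck_def)

lemma dyck_first_return:
  assumes "dyck \<alpha>" "dyck \<beta>"
  shows "dyck (U # \<alpha> @ D # \<beta>)"
proof -
  have "level (take k (U # \<alpha> @ D # \<beta>)) \<ge> 0" if "k \<le> length (U # \<alpha> @ D # \<beta>)" for k
  proof (cases "k \<le> Suc (length \<alpha>)")
    case True
    then show ?thesis
      using assms(1) by (cases k) (auto simp: dyck_def)
  next
    case False
    then obtain j where j: "k = Suc (Suc (length \<alpha> + j))"
      by (metis add_Suc less_imp_Suc_add not_le)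
    then have "j \<le> length \<beta>"
      using that by simp
    then show ?thesis
      using assms j by (auto simp: dyck_def)
  qed
  then show ?thesis
    using assms by (auto simp: dyck_def)
qed

lemma DH_imp_dyck: "P \<in> DH \<Longrightarrow> dyck P"
  by (induction rule: DH.induct) (auto intro: dyck_first_return)

lemma dyck_prefix_not_D:
  assumes "dyck \<alpha>'" "\<alpha> @ D # \<beta> = \<alpha>' @ D # \<beta>'" "level \<alpha> = 0"
  shows "length \<alpha>' \<le> length \<alpha>"
proof (rule ccontr)
  assume "\<not> ?thesis"
  then have l: "Suc (length \<alpha>) \<le> length \<alpha>'"
    by simp
  have "take (Suc (length \<alpha>)) \<alpha>' = take (Suc (length \<alpha>)) (\<alpha>' @ D # \<beta>')"
    using l by simp
  also have "\<dots> = \<alpha> @ [D]"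
    by (simp flip: assms(2))
  finally have "level (take (Suc (length \<alpha>)) \<alpha>') = -1"
    using assms(3) by simp
  then show False
    using assms(1) l unfolding dyck_def by fastforce
qed

lemma first_return_unique:
  assumes "dyck \<alpha>" "dyck \<alpha>'" "U # \<alpha> @ D # \<beta> = U # \<alpha>' @ D # \<beta>'"
  shows "\<alpha> = \<alpha>' \<and> \<beta> = \<beta>'"
proof -
  have eq: "\<alpha> @ D # \<beta> = \<alpha>' @ D # \<beta>'"
    using assms(3) by simp
  have "length \<alpha> = length \<alpha>'"
    using dyck_prefix_not_D[OF assms(2) eq] dyck_prefix_not_D[OF assms(1) eq[symmetric]] assms(1,2)
    by (simp add: dyck_def)
  then show ?thesis
    using eq by simp
qed

lemma DH_first_return_iff:
  assumes "dyck \<alpha>" "dyck \<beta>"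
  shows "U # \<alpha> @ D # \<beta> \<in> DH \<longleftrightarrow>
    \<alpha> \<in> DH \<and> \<beta> \<in> DH \<and> height (U # \<alpha> @ [D]) \<ge> height \<beta>"
proof
  assume "U # \<alpha> @ D # \<beta> \<in> DH"
  then show "\<alpha> \<in> DH \<and> \<beta> \<in> DH \<and> height (U # \<alpha> @ [D]) \<ge> height \<beta>"
    by (cases rule: DH.cases) (use assms first_return_unique in blast)+
qed (use assms in \<open>auto intro: DH.first_return\<close>)

lemma finite_DH_n: "finite (DH_n n)"
proof -
  have "finite (UNIV :: step set)"
    by (rule finite_subset[of _ "{U, D}"]) (use step.exhaust in auto)
  then have "finite {P :: step list. set P \<subseteq> UNIV \<and> length P = 2 * n}"
    by (rule finite_lists_length_eq)
  then show ?thesis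
    by (rule rev_finite_subset) (auto simp: DH_n_def)
qed

section \<open>Pattern occurrences and generating functions\<close>

definition occurrences :: "step list \<Rightarrow> step list \<Rightarrow> nat" where
  "occurrences p P = card {i. i + length p \<le> length P \<and> take (length p) (drop i P) = p}"

definition num_paths :: "step list \<Rightarrow> nat \<Rightarrow> nat \<Rightarrow> nat" where
  "num_paths p n k = card {P \<in> DH_n n. occurrences p P = k}"

text \<open>
  Bivariate formal power series over the rationals are represented as power series in \<open>x\<close>
  whose coefficients are power series in \<open>y\<close>.
\<close>

abbreviation X :: "rat fps fps" where "X \<equiv> fps_X"
abbreviation Y :: "rat fps fps" where "Y \<equiv> fps_const fps_X"

definition F :: "step list \<Rightarrow> rat fps fps" where
  "F p = Abs_fps (\<lambda>n. Abs_fps (\<lambda>k. of_nat (num_paths p n k)))"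

text \<open>
  A bivariate power series with constant term \<open>1\<close> has exactly two square roots, which differ
  by sign; \<open>fps2_sqrt\<close> is the one with constant term \<open>1\<close>. It is unspecified for series whose
  constant term is not \<open>1\<close>.
\<close>

definition fps2_sqrt :: "rat fps fps \<Rightarrow> rat fps fps" where
  "fps2_sqrt R = (THE S. S ^ 2 = R \<and> fps_nth (fps_nth S 0) 0 = 1)"

lemma fps2_sqrt_eqI:
  assumes "S ^ 2 = R" "fps_nth (fps_nth S 0) 0 = 1"
  shows "fps2_sqrt R = S"
  unfolding fps2_sqrt_def
proof (rule the_equality)
  fix T :: "rat fps fps"
  assume T: "T ^ 2 = R \<and> fps_nth (fps_nth T 0) 0 = 1"
  then have "T = S \<or> T = - S"
    using assms(1) by (metis power2_eq_iff)
  then show "T = S"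
    using T assms(2) by auto
qed (use assms in simp)

end

theory Submission
  imports Defs
begin

text \<open>
  In a path \<open>P = U \<alpha> D \<beta>\<close> of \<^const>\<open>DH\<close> the height of \<open>P\<close> is one more than that of \<open>\<alpha>\<close>, and the
  number of occurrences of a pattern \<open>a U b\<close> in \<open>P\<close> is the sum over \<open>\<alpha>\<close> and \<open>\<beta>\<close> plus corrections
  that depend only on the heights of \<open>\<alpha>\<close> and \<open>\<beta>\<close>. So the series \<open>A\<^sub>k\<close> of the paths of height \<open>k\<close>
  satisfies \<open>A\<^sub>k\<^sub>+\<^sub>1 = x s\<^sub>k A\<^sub>k B\<^sub>k\<^sub>+\<^sub>1\<close> with \<open>B\<^sub>k = t\<^sub>0 A\<^sub>0 + \<dots> + t\<^sub>k A\<^sub>k\<close>, where \<open>s\<^sub>k\<close> and \<open>t\<^sub>k\<close> are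
  \<open>1\<close> or \<open>y\<close> and constant from \<open>k = 2\<close> on. With \<open>E\<^sub>k = x s\<^sub>k t\<^sub>k\<^sub>+\<^sub>1 A\<^sub>k\<close> and \<open>q = x s\<^sub>2\<close> this becomes
  \<open>B\<^sub>k = B\<^sub>k\<^sub>+\<^sub>1 (1 - E\<^sub>k)\<close>, \<open>E\<^sub>k\<^sub>+\<^sub>1 = q E\<^sub>k B\<^sub>k\<^sub>+\<^sub>1\<close>, a nonlinear recurrence with the conserved quantity
  \<open>(1 + q\<^sup>2 B\<^sub>k\<^sup>2 - q E\<^sub>k B\<^sub>k - E\<^sub>k) / B\<^sub>k\<close>. Comparing its value at \<open>k = 1\<close> with the limit, where \<open>E\<^sub>k\<close>
  vanishes, gives a quadratic equation for the limit of \<open>B\<^sub>k\<close>.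
\<close>

section \<open>Heights and concatenation\<close>

lemma height_Nil [simp]: "height [] = 0"
  by (simp add: height_def)

text \<open>Nonempty prefixes are \<open>a\<close> followed by a prefix of \<open>P\<close>, and
  \<open>Max\<close> commutes with the monotone shift by \<open>rise a\<close>; the \<open>0\<close>
  comes from the empty prefix.\<close>

lemma height_Cons [simp]: "height (a # P) = max 0 (rise a + height P)"
proof -
  have "height (a # P) = Max (insert 0 ((\<lambda>x. rise a + x) ` (\<lambda>k. level (take k P)) ` {..length P}))"
    by (simp add: height_def atMost_Suc_eq_insert_0 image_image)
  also have "\<dots> = max 0 (Max ((\<lambda>x. rise a + x) ` (\<lambda>k. level (take k P)) ` {..length P}))"
    by simp
  also have "Max ((\<lambda>x. rise a + x) ` (\<lambda>k. level (take k P)) ` {..length P}) = rise a + height P"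
    unfolding height_def by (rule mono_Max_commute[symmetric]) (auto simp: mono_def)
  finally show ?thesis .
qed

lemma height_nonneg: "height P \<ge> 0"
  by (cases P) auto

lemma height_append: "height (P @ Q) = max (height P) (level P + height Q)"
  by (induction P) (use height_nonneg[of Q] in auto)

lemma level_dyck: "dyck P \<Longrightarrow> level P = 0"
  by (simp add: dyck_def)

lemma height_first_return:
  assumes "dyck \<alpha>" "height \<beta> \<le> height (U # \<alpha> @ [D])"
  shows "height (U # \<alpha> @ D # \<beta>) = height \<alpha> + 1"
  using assms height_nonneg[of \<alpha>] height_nonneg[of \<beta>] by (auto simp: height_append level_dyck)

lemma height_UD: "dyck \<alpha> \<Longrightarrow> height (U # \<alpha> @ [D]) = height \<alpha> + 1"
  using height_nonneg[of \<alpha>] by (auto simp: height_append level_dyck)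

section \<open>Paths of \<open>DH\<close> graded by height\<close>

definition ht :: "step list \<Rightarrow> nat" where
  "ht P = nat (height P)"

lemma ht_Nil [simp]: "ht [] = 0"
  by (simp add: ht_def)

lemma DH_first_return_iff_ht:
  assumes "dyck \<alpha>" "dyck \<beta>"
  shows "U # \<alpha> @ D # \<beta> \<in> DH \<longleftrightarrow> \<alpha> \<in> DH \<and> \<beta> \<in> DH \<and> ht \<beta> \<le> Suc (ht \<alpha>)"
  using height_nonneg[of \<alpha>] height_nonneg[of \<beta>] DH_first_return_iff[OF assms] height_UD[OF assms(1)]
  by (auto simp: ht_def)

lemma ht_first_return:
  assumes "U # \<alpha> @ D # \<beta> \<in> DH" "dyck \<alpha>" "dyck \<beta>"
  shows "ht (U # \<alpha> @ D # \<beta>) = Suc (ht \<alpha>)"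
  using height_first_return[of \<alpha> \<beta>] assms DH_first_return_iff[OF assms(2,3)] height_nonneg[of \<alpha>]
  unfolding ht_def by force

lemma DH_cases_ht:
  assumes "P \<in> DH"
  obtains (Nil) "P = []"
  | (first_return) \<alpha> \<beta> where "P = U # \<alpha> @ D # \<beta>" "\<alpha> \<in> DH" "\<beta> \<in> DH" "ht \<beta> \<le> Suc (ht \<alpha>)" "ht P = Suc (ht \<alpha>)"
  using assms
proof (cases rule: DH.cases)
  case (first_return \<alpha> \<beta>)
  then show ?thesis
    using that(2) assms DH_first_return_iff_ht ht_first_return by blast
qed (use that in auto)

lemma ht_eq_0_iff: "P \<in> DH \<Longrightarrow> ht P = 0 \<longleftrightarrow> P = []"
  by (auto elim: DH_cases_ht)

text \<open>The length bound later gives convergence: tall paths affect only high powers of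
  \<open>X\<close>.\<close>

lemma DH_length: "P \<in> DH \<Longrightarrow> even (length P) \<and> 2 * ht P \<le> length P"
proof (induction rule: DH.induct)
  case (first_return \<alpha> \<beta>)
  then have "ht (U # \<alpha> @ D # \<beta>) = Suc (ht \<alpha>)"
    by (intro ht_first_return DH.first_return)
  then show ?case using first_return by auto
qed auto

lemma DH_last: "P \<in> DH \<Longrightarrow> P \<noteq> [] \<Longrightarrow> last P = D"
  by (induction rule: DH.induct) auto

text \<open>The second step is \<open>D\<close> exactly when the \<open>\<alpha>\<close> of the
  first return decomposition is empty, that is, of height 0. This turns local pattern conditions
  into height conditions.\<close>

lemma take_2_DH:
  assumes "P \<in> DH"
  shows "take 2 P = [U, U] \<longleftrightarrow> ht P \<ge> 2" "take 2 P = [U, D] \<longleftrightarrow> ht P = 1"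
  using assms
  by (cases rule: DH_cases_ht; (cases "ht P"; auto elim: DH_cases_ht simp: ht_eq_0_iff; fail))+

section \<open>Occurrences of patterns with middle step \<open>U\<close>\<close>

lemma occurrences_Nil [simp]: "p \<noteq> [] \<Longrightarrow> occurrences p [] = 0"
  by (simp add: occurrences_def)

lemma occurrences_Cons:
  assumes "p \<noteq> []"
  shows "occurrences p (a # P) = of_bool (take (length p) (a # P) = p) + occurrences p P"
proof -
  let ?O = "\<lambda>P. {i. i + length p \<le> length P \<and> take (length p) (drop i P) = p}"
  have fin: "finite (?O P)"
    by (rule finite_subset[of _ "{..length P}"]) auto
  have eq: "?O (a # P) = (if take (length p) (a # P) = p then {0} else {}) \<union> Suc ` ?O P" (is "?L = ?R")
  proof (rule set_eqI)
    fix i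
    show "i \<in> ?L \<longleftrightarrow> i \<in> ?R"
    proof (cases i)
      case 0
      have "length p \<le> length (a # P)" if "take (length p) (a # P) = p"
        using arg_cong[OF that, of length] by simp
      with 0 show ?thesis by auto
    qed auto
  qed
  show ?thesis
    unfolding occurrences_def eq using fin by (auto simp: card_image card_insert_if)
qed

text \<open>A window of three steps that starts in \<open>\<alpha>\<close> and leaves it has as its
  middle step either the last step of \<open>\<alpha>\<close> or the \<open>D\<close> after it. Both
  are \<open>D\<close>, so it cannot be an occurrence.\<close>

lemma occurrences_append_D:
  assumes "\<alpha> \<noteq> [] \<longrightarrow> last \<alpha> = D"
  shows "occurrences [a, U, b] (\<alpha> @ D # \<beta>) = occurrences [a, U, b] \<alpha> + occurrences [a, U, b] (D # \<beta>)"
  using assms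
proof (induction \<alpha>)
  case (Cons c \<alpha>)
  have "take 3 (c # \<alpha> @ D # \<beta>) = [a, U, b] \<longleftrightarrow> take 3 (c # \<alpha>) = [a, U, b]"
  proof (cases \<alpha>)
    case (Cons d \<gamma>)
    with Cons.prems show ?thesis 
      by (cases \<gamma>) (auto simp: numeral_3_eq_3)
  qed (auto simp: numeral_3_eq_3)
  then have "occurrences [a, U, b] (c # \<alpha> @ D # \<beta>) =
    of_bool (take 3 (c # \<alpha>) = [a, U, b]) + occurrences [a, U, b] (\<alpha> @ D # \<beta>)"
    by (simp add: occurrences_Cons eval_nat_numeral del: take_Suc_Cons)
  moreover have "occurrences [a, U, b] (c # \<alpha>) =
    of_bool (take 3 (c # \<alpha>) = [a, U, b]) + occurrences [a, U, b] \<alpha>"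
    by (simp add: occurrences_Cons eval_nat_numeral)
  moreover have "\<alpha> \<noteq> [] \<longrightarrow> last \<alpha> = D"
    using Cons.prems by auto
  ultimately show ?case
    using Cons.IH by simp
qed auto

lemma occurrences_first_return:
  assumes "\<alpha> \<in> DH"
  shows "occurrences [a, U, b] (U # \<alpha> @ D # \<beta>) =
    of_bool (a = U \<and> take 2 \<alpha> = [U, b]) + occurrences [a, U, b] \<alpha> +
    (of_bool (a = D \<and> take 2 \<beta> = [U, b]) + occurrences [a, U, b] \<beta>)"
proof -
  \<comment> \<open>An empty \<open>\<alpha>\<close> puts \<open>D\<close> first, and parity
    excludes a one-step \<open>\<alpha>\<close>.\<close>
  have "take 2 (\<alpha> @ D # \<beta>) = [U, b] \<longleftrightarrow> take 2 \<alpha> = [U, b]"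
    using DH_length[OF assms] by (cases \<alpha>; cases "tl \<alpha>") auto
  then have "occurrences [a, U, b] (U # \<alpha> @ D # \<beta>) =
    of_bool (a = U \<and> take 2 \<alpha> = [U, b]) + occurrences [a, U, b] (\<alpha> @ D # \<beta>)"
    by (auto simp: occurrences_Cons numeral_2_eq_2)
  then show ?thesis
    using DH_last[OF assms] by (auto simp: occurrences_append_D occurrences_Cons numeral_2_eq_2)
qed

section \<open>Weighted generating functions by semilength\<close>

definition gf :: "(step list \<Rightarrow> rat fps) \<Rightarrow> step list set \<Rightarrow> rat fps fps" where
  "gf w S = Abs_fps (\<lambda>n. \<Sum>P | P \<in> S \<and> length P = 2 * n. w P)"

lemma gf_nth: "fps_nth (gf w S) n = (\<Sum>P | P \<in> S \<and> length P = 2 * n. w P)"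
  by (simp add: gf_def)

lemma finite_DH_length: "S \<subseteq> DH \<Longrightarrow> finite {P \<in> S. length P = 2 * n}"
  by (rule finite_subset[OF _ finite_DH_n[of n]]) (auto simp: DH_n_def)

lemma gf_cong: "(\<And>P. P \<in> S \<Longrightarrow> w P = w' P) \<Longrightarrow> gf w S = gf w' S"
  by (auto simp: gf_def intro!: sum.cong)

lemma gf_scale: "gf (\<lambda>P. c * w P) S = fps_const c * gf w S"
  by (intro fps_ext) (simp add: gf_nth sum_distrib_left)

lemma gf_Un:
  assumes "S \<subseteq> DH" "T \<subseteq> DH" "S \<inter> T = {}"
  shows "gf w (S \<union> T) = gf w S + gf w T"
proof (rule fps_ext)
  fix n
  have "{P. P \<in> S \<union> T \<and> length P = 2 * n} = {P \<in> S. length P = 2 * n} \<union> {P \<in> T. length P = 2 * n}"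
    by auto
  with assms show "fps_nth (gf w (S \<union> T)) n = fps_nth (gf w S + gf w T) n"
    by (auto simp: gf_nth intro!: sum.union_disjoint finite_DH_length)
qed

text \<open>Uniqueness of the first return decomposition makes this a Cauchy product; the factor
  \<open>X\<close> accounts for the added pair \<open>U\<close>, \<open>D\<close>.\<close>

lemma gf_first_return:
  assumes S: "S \<subseteq> DH" and T: "T \<subseteq> DH"
    and w: "\<And>\<alpha> \<beta>. \<alpha> \<in> S \<Longrightarrow> \<beta> \<in> T \<Longrightarrow> w (U # \<alpha> @ D # \<beta>) = u \<alpha> * v \<beta>"
  shows "gf w {U # \<alpha> @ D # \<beta> | \<alpha> \<beta>. \<alpha> \<in> S \<and> \<beta> \<in> T} = X * (gf u S * gf v T)"
    (is "gf w ?R = _")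
proof (rule fps_ext)
  fix n
  show "fps_nth (gf w ?R) n = fps_nth (X * (gf u S * gf v T)) n"
  proof (cases n)
    case (Suc m)
    let ?S = "\<lambda>i. {\<alpha> \<in> S. length \<alpha> = 2 * i}" and ?T = "\<lambda>i. {\<beta> \<in> T. length \<beta> = 2 * i}"
    \<comment> \<open>The index \<open>i\<close> is the semilength of \<open>\<alpha>\<close>, which
      leaves \<open>m - i\<close> for \<open>\<beta>\<close>.\<close>
    let ?I = "Sigma {0..m} (\<lambda>i. ?S i \<times> ?T (m - i))"
    let ?f = "\<lambda>(i :: nat, \<alpha>, \<beta>). U # \<alpha> @ D # \<beta>"
    have "bij_betw ?f ?I {P \<in> ?R. length P = 2 * n}"
      unfolding bij_betw_def
    proof
      show "inj_on ?f ?I"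
      proof (rule inj_onI)
        fix x y assume *: "x \<in> ?I" "y \<in> ?I" "?f x = ?f y"
        obtain i \<alpha> \<beta> j \<alpha>' \<beta>' where xy: "x = (i, \<alpha>, \<beta>)" "y = (j, \<alpha>', \<beta>')"
          by (metis prod_cases3)
        have "\<alpha> = \<alpha>' \<and> \<beta> = \<beta>'"
          using * xy S DH_imp_dyck by (intro first_return_unique) auto
        with * xy show "x = y" by auto
      qed
      show "?f ` ?I = {P \<in> ?R. length P = 2 * n}"
      proof (intro equalityI subsetI)
        fix P assume "P \<in> {P \<in> ?R. length P = 2 * n}"
        then obtain \<alpha> \<beta> where P: "P = U # \<alpha> @ D # \<beta>" "\<alpha> \<in> S" "\<beta> \<in> T" "length P = 2 * n"
          by blast
        moreover obtain i j where "length \<alpha> = 2 * i" "length \<beta> = 2 * j"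
          using P S T DH_length by (meson evenE subsetD)
        ultimately have "P = ?f (i, \<alpha>, \<beta>)" "(i, \<alpha>, \<beta>) \<in> ?I"
          using Suc by auto
        then show "P \<in> ?f ` ?I" by (rule image_eqI)
      qed (use Suc in auto)
    qed
    then have "fps_nth (gf w ?R) n = (\<Sum>x\<in>?I. w (?f x))"
      unfolding gf_nth by (simp only: sum.reindex_bij_betw)
    also have "\<dots> = (\<Sum>(i, \<alpha>, \<beta>)\<in>?I. u \<alpha> * v \<beta>)"
      by (rule sum.cong) (auto simp: w)
    also have "\<dots> = (\<Sum>i=0..m. \<Sum>(\<alpha>, \<beta>)\<in>?S i \<times> ?T (m - i). u \<alpha> * v \<beta>)"
      using S T by (subst sum.Sigma) (auto simp: finite_DH_length)
    also have "\<dots> = (\<Sum>i=0..m. (\<Sum>\<alpha>\<in>?S i. u \<alpha>) * (\<Sum>\<beta>\<in>?T (m - i). v \<beta>))"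
      by (simp add: sum_product sum.cartesian_product)
    also have "\<dots> = fps_nth (X * (gf u S * gf v T)) n"
      using Suc by (simp add: gf_nth fps_mult_nth[of "gf u S"])
    finally show ?thesis .
  qed (auto simp: gf_nth intro!: sum.neutral)
qed

lemma F_eq_gf: "F p = gf (\<lambda>P. fps_X ^ occurrences p P) DH"
proof (intro fps_ext)
  fix n k
  have *: "{P. P \<in> DH \<and> length P = 2 * n} = DH_n n"
    by (auto simp: DH_n_def)
  show "fps_nth (fps_nth (F p) n) k = fps_nth (fps_nth (gf (\<lambda>P. fps_X ^ occurrences p P) DH) n) k"
    using finite_DH_n[of n]
    by (simp add: F_def gf_nth * fps_sum_nth num_paths_def fps_X_power_nth sum.If_cases Int_def eq_commute)
qed

section \<open>Divisibility by powers of the variable\<close>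

lemma fps_X_power_dvdI:
  fixes f :: "'a :: comm_ring_1 fps"
  assumes "\<And>n. n < k \<Longrightarrow> fps_nth f n = 0"
  shows "fps_X ^ k dvd f"
proof
  show "f = fps_X ^ k * fps_shift k f"
    using assms by (intro fps_ext) (simp add: fps_X_power_mult_nth)
qed

text \<open>Stands in for passing to the limit: an identity holds once it holds modulo every power
  of the variable.\<close>

lemma fps_eq_0I:
  fixes f :: "'a :: comm_ring_1 fps"
  assumes "\<And>k. fps_X ^ Suc k dvd f"
  shows "f = 0"
proof (rule fps_ext)
  fix n
  obtain g where "f = fps_X ^ Suc n * g" using assms dvdE by blast
  then show "fps_nth f n = fps_nth 0 n" by (simp only: fps_X_power_mult_nth) simp
qed

section \<open>Recurrences over the height\<close>

locale weighted_DH =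
  fixes w :: "step list \<Rightarrow> rat fps" and s t :: "nat \<Rightarrow> rat fps"
  assumes w_Nil: "w [] = 1"
    and w_first_return: "\<And>\<alpha> \<beta>. \<alpha> \<in> DH \<Longrightarrow> \<beta> \<in> DH \<Longrightarrow>
      w (U # \<alpha> @ D # \<beta>) = (s (ht \<alpha>) * w \<alpha>) * (t (ht \<beta>) * w \<beta>)"
    and s_0: "s 0 = 1" and t_0: "t 0 = 1"
    and s_ge_2: "\<And>k. k \<ge> 2 \<Longrightarrow> s k = s 2" and t_ge_2: "\<And>k. k \<ge> 2 \<Longrightarrow> t k = t 2"
begin

definition A :: "nat \<Rightarrow> rat fps fps" where
  "A k = gf w {P \<in> DH. ht P = k}"

text \<open>Series of the tails \<open>\<beta>\<close> allowed after a first return when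
  \<open>ht \<alpha> + 1 = k\<close>; \<open>t\<close> weighs the correction at the join of
  \<open>D\<close> and \<open>\<beta>\<close>.\<close>

definition B :: "nat \<Rightarrow> rat fps fps" where
  "B k = gf (\<lambda>P. t (ht P) * w P) {P \<in> DH. ht P \<le> k}"

definition G :: "rat fps fps" where
  "G = gf (\<lambda>P. t (ht P) * w P) DH"

text \<open>Chosen so that \<open>B (Suc k) * E k\<close> is the increment from \<open>B k\<close>
  to \<open>B (Suc k)\<close>.\<close>

definition E :: "nat \<Rightarrow> rat fps fps" where
  "E k = X * fps_const (s k) * fps_const (t (Suc k)) * A k"

lemma gf_scale_ht: "gf (\<lambda>P. f (ht P) * w P) {P \<in> DH. ht P = k} = fps_const (f k) * A k"
  unfolding A_def gf_scale[symmetric] by (rule gf_cong) auto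

lemma A_0: "A 0 = 1"
proof -
  have *: "{P \<in> DH. ht P = 0} = {[]}"
    using ht_eq_0_iff by (auto intro: DH.empty)
  show ?thesis
  proof (rule fps_ext)
    fix n
    have "{P. P \<in> {[]} \<and> length P = 2 * n} = (if n = 0 then {[]} else {} :: step list set)"
      by auto
    then show "fps_nth (A 0) n = fps_nth 1 n"
      by (simp add: A_def * gf_nth w_Nil)
  qed
qed

lemma A_Suc: "A (Suc k) = X * (fps_const (s k) * A k * B (Suc k))"
proof -
  have "{P \<in> DH. ht P = Suc k} = {U # \<alpha> @ D # \<beta> | \<alpha> \<beta>.
      \<alpha> \<in> {P \<in> DH. ht P = k} \<and> \<beta> \<in> {P \<in> DH. ht P \<le> Suc k}}" (is "?L = ?R")
  proof (intro equalityI subsetI)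
    fix P assume "P \<in> ?L"
    then have "P \<in> DH" "ht P = Suc k" by auto
    then show "P \<in> ?R"
      by (cases rule: DH_cases_ht) auto
  next
    fix P assume "P \<in> ?R"
    then show "P \<in> ?L"
      using DH_first_return_iff_ht ht_first_return DH_imp_dyck by auto
  qed
  then have "A (Suc k) = gf w ?R" by (simp only: A_def)
  also have "\<dots> = X * (gf (\<lambda>P. s (ht P) * w P) {P \<in> DH. ht P = k} * B (Suc k))"
    unfolding B_def by (rule gf_first_return) (auto simp: w_first_return)
  finally show ?thesis by (simp add: gf_scale_ht)
qed

lemma B_0: "B 0 = 1"
  using gf_scale_ht[of t 0] by (simp add: B_def A_0 t_0)

lemma B_Suc: "B (Suc k) = B k + fps_const (t (Suc k)) * A (Suc k)"
proof -
  have "{P \<in> DH. ht P \<le> Suc k} = {P \<in> DH. ht P \<le> k} \<union> {P \<in> DH. ht P = Suc k}"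
    by auto
  then have "B (Suc k) = B k + gf (\<lambda>P. t (ht P) * w P) {P \<in> DH. ht P = Suc k}"
    unfolding B_def by (simp only:) (rule gf_Un; auto)
  then show ?thesis by (simp only: gf_scale_ht)
qed

lemma B_step: "B k = B (Suc k) * (1 - E k)"
proof -
  have "B (Suc k) * E k = fps_const (t (Suc k)) * A (Suc k)"
    by (simp only: E_def A_Suc mult_ac)
  then show ?thesis
    using B_Suc[of k] by (simp add: right_diff_distrib)
qed

definition q :: "rat fps fps" where
  "q = X * fps_const (s 2)"

lemma E_step:
  assumes "k \<ge> 1"
  shows "E (Suc k) = q * E k * B (Suc k)"
proof -
  \<comment> \<open>For \<open>k \<ge> 1\<close> all indices here are at least 2, where
    \<open>s\<close> and \<open>t\<close> are constant.\<close>
  have "s (Suc k) = s 2" "t (Suc (Suc k)) = t (Suc k)"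
    using assms s_ge_2[of "Suc k"] t_ge_2[of "Suc k"] t_ge_2[of "Suc (Suc k)"] by auto
  then show ?thesis
    by (simp only: E_def A_Suc q_def mult_ac)
qed

text \<open>
  The reciprocals \<open>d\<^sub>k = 1 / E\<^sub>k\<close> satisfy \<open>d\<^sub>k\<^sub>-\<^sub>1 d\<^sub>k\<^sub>+\<^sub>1 = d\<^sub>k\<^sup>2 - d\<^sub>k\<close>, for which
  \<open>(d\<^sub>k\<^sub>-\<^sub>1 + d\<^sub>k\<^sub>+\<^sub>1 - 1) / d\<^sub>k\<close> is constant. In terms of \<open>B\<close> and \<open>E\<close> this constant is \<open>I k / (q B k)\<close>.
\<close>

definition I :: "nat \<Rightarrow> rat fps fps" where
  "I k = 1 + q\<^sup>2 * (B k)\<^sup>2 - q * E k * B k - E k"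

lemma I_step:
  assumes "k \<ge> 1"
  shows "I k * B (Suc k) = I (Suc k) * B k"
  unfolding I_def E_step[OF assms] B_step[of k]
  by (simp add: algebra_simps power2_eq_square)

text \<open>Allows cancelling \<open>B k\<close> when the cross-multiplied steps of the invariant
  are chained.\<close>

lemma B_nonzero: "B k \<noteq> 0"
proof (induction k)
  case (Suc k)
  then show ?case using B_step[of k] by auto
qed (simp add: B_0)

lemma I_invariant: "k \<ge> 1 \<Longrightarrow> I k * B 1 = I 1 * B k"
proof (induction k rule: dec_induct)
  case (step k)
  have "(I (Suc k) * B 1) * B k = (I 1 * B (Suc k)) * B k"
    using step I_step[of k] by (metis (no_types, lifting) mult.assoc mult.commute)
  then show ?case
    using B_nonzero[of k] by simp
qed simp

section \<open>Passage to the limit\<close>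

lemma X_power_dvd_A: "X ^ k dvd A k"
  by (induction k) (auto simp: A_Suc intro!: mult_dvd_mono dvd_mult dvd_mult2)

text \<open>A path of height above \<open>k\<close> has semilength above \<open>k\<close>, so the
  coefficients up to \<open>k\<close> agree.\<close>

lemma X_power_dvd_G_diff: "X ^ Suc k dvd G - B k"
proof (rule fps_X_power_dvdI)
  fix n assume "n < Suc k"
  then have "{P. P \<in> DH \<and> length P = 2 * n} = {P. P \<in> {P \<in> DH. ht P \<le> k} \<and> length P = 2 * n}"
    using DH_length by fastforce
  then show "fps_nth (G - B k) n = 0"
    by (simp only: fps_sub_nth G_def B_def gf_nth) simp
qed

lemma X_power_dvd_E: "X ^ Suc k dvd E k"
  unfolding E_def mult.assoc power_Suc
  by (intro mult_dvd_mono dvd_refl dvd_mult X_power_dvd_A)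

lemma limit_equation:
  "(1 + q\<^sup>2 * G\<^sup>2) * B 1 = I 1 * G"
proof -
  have *: "X ^ Suc k dvd (1 + q\<^sup>2 * G\<^sup>2) * B 1 - I 1 * G" if "k \<ge> 1" for k
  proof -
    \<comment> \<open>Compares the equation with the invariant at \<open>k\<close>: replacing
      \<open>G\<close> by \<open>B k\<close> and restoring the terms with \<open>E k\<close> leaves
      errors divisible by \<open>X ^ Suc k\<close>.\<close>
    have "(1 + q\<^sup>2 * G\<^sup>2) * B 1 - I 1 * G =
        (G - B k) * (q\<^sup>2 * (G + B k) * B 1 - I 1) + E k * ((q * B k + 1) * B 1)
        + (I k * B 1 - I 1 * B k)"
      by (simp add: I_def[of k] algebra_simps power2_eq_square)
    also have "\<dots> = (G - B k) * (q\<^sup>2 * (G + B k) * B 1 - I 1) + E k * ((q * B k + 1) * B 1)"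
      using I_invariant[OF that] by simp
    finally show ?thesis
      using X_power_dvd_G_diff[of k] X_power_dvd_E[of k] by simp
  qed
  have "X ^ Suc k dvd (1 + q\<^sup>2 * G\<^sup>2) * B 1 - I 1 * G" for k
    by (rule power_le_dvd[OF *[of "Suc k"]]) auto
  then have "(1 + q\<^sup>2 * G\<^sup>2) * B 1 - I 1 * G = 0"
    by (rule fps_eq_0I)
  then show ?thesis by simp
qed

section \<open>The quadratic equation for \<open>G\<close> and its solution\<close>

text \<open>\<open>z\<close> is \<open>1 / B 1\<close> and \<open>M\<close> is \<open>z\<^sup>2 * I 1\<close>.\<close>

definition z :: "rat fps fps" where
  "z = 1 - X * fps_const (t 1)"

definition M :: "rat fps fps" where
  "M = z\<^sup>2 + q\<^sup>2 - (q + z) * X\<^sup>2 * fps_const (t 2) * fps_const (s 1)"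

lemma z_B_1: "z * B 1 = 1"
  using B_step[of 0] by (simp add: B_0 z_def E_def A_0 s_0 mult.commute)

lemma z_A_1: "z * A 1 = X"
proof -
  have "z * A 1 = X * (z * B 1)"
    using A_Suc[of 0] by (simp add: A_0 s_0)
  then show ?thesis by (simp only: z_B_1 mult_1_right)
qed

lemma z_E_1: "z * E 1 = X\<^sup>2 * fps_const (t 2) * fps_const (s 1)"
proof -
  have "z * E 1 = X * fps_const (t 2) * fps_const (s 1) * (z * A 1)"
    by (simp only: E_def numeral_2_eq_2 One_nat_def mult_ac)
  then show ?thesis by (simp only: z_A_1 power2_eq_square mult_ac)
qed

text \<open>Multiplying \<open>limit_equation\<close> by \<open>z\<^sup>2\<close> clears the
  denominators, since \<open>z * B 1 = 1\<close>.\<close>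

lemma quadratic_equation:
  "(1 + q\<^sup>2 * G\<^sup>2) * z = M * G"
proof -
  have "z\<^sup>2 * I 1 = z\<^sup>2 + q\<^sup>2 * (z * B 1)\<^sup>2 - q * (z * E 1) * (z * B 1) - z * (z * E 1)"
    by (simp add: I_def algebra_simps power2_eq_square)
  also have "\<dots> = M"
    unfolding z_B_1 z_E_1 M_def by (simp add: algebra_simps)
  finally have M: "z\<^sup>2 * I 1 = M" .
  have "(1 + q\<^sup>2 * G\<^sup>2) * z = z * ((1 + q\<^sup>2 * G\<^sup>2) * (z * B 1))"
    by (simp only: z_B_1 mult_1_left mult_1_right mult.commute)
  also have "\<dots> = z\<^sup>2 * ((1 + q\<^sup>2 * G\<^sup>2) * B 1)"
    by (simp only: power2_eq_square mult_ac)
  also have "\<dots> = M * G"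
    unfolding limit_equation M[symmetric] by (simp add: mult.assoc)
  finally show ?thesis .
qed

text \<open>Completing the square in \<open>q\<^sup>2 * z * G\<^sup>2 - M * G + z = 0\<close>; the
  discriminant is a difference of squares. The sign is fixed by the constant term 1, as
  \<open>q\<close> vanishes and \<open>z\<close> is 1 at \<open>X = 0\<close>.\<close>

lemma sqrt_discriminant:
  "fps2_sqrt ((M - 2 * q * z) * (M + 2 * q * z)) =
    M - 2 * q\<^sup>2 * (z * G)"
proof (rule fps2_sqrt_eqI)
  have "(M - 2 * q\<^sup>2 * (z * G))\<^sup>2 =
      M\<^sup>2 - 4 * q\<^sup>2 * z * (M * G) + 4 * q\<^sup>2 * z * (q\<^sup>2 * G\<^sup>2 * z)"
    by (simp add: algebra_simps power2_eq_square)
  also have "q\<^sup>2 * G\<^sup>2 * z = M * G - z"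
    using quadratic_equation by (simp add: algebra_simps)
  finally show "(M - 2 * q\<^sup>2 * (z * G))\<^sup>2 = (M - 2 * q * z) * (M + 2 * q * z)"
    by (simp add: algebra_simps power2_eq_square)
qed (simp add: M_def z_def q_def power2_eq_square)

text \<open>Recovers the series of all paths from \<open>G\<close>: only heights 0 and 1 can carry a
  tail weight other than \<open>t 2\<close>, and their series are 1 and
  \<open>X / z\<close>.\<close>

lemma z_G: "z * G = z * fps_const (1 - t 2) + X * fps_const (t 1 - t 2) + z * fps_const (t 2) * gf w DH"
proof -
  let ?H = "{P \<in> DH. ht P \<ge> 2}"
  have DH: "DH = {P \<in> DH. ht P = 0} \<union> ({P \<in> DH. ht P = 1} \<union> ?H)"
    by auto
  have by_height: "gf v DH = gf v {P \<in> DH. ht P = 0} + (gf v {P \<in> DH. ht P = 1} + gf v ?H)" for v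
    by (subst DH, subst gf_Un; (subst gf_Un)?) auto
  have "gf (\<lambda>P. t (ht P) * w P) ?H = fps_const (t 2) * gf w ?H"
    unfolding gf_scale[symmetric] by (rule gf_cong) (simp add: t_ge_2[of "ht P" for P])
  then have "G = 1 + fps_const (t 1) * A 1 + fps_const (t 2) * gf w ?H"
    unfolding G_def by (subst by_height) (simp add: gf_scale_ht A_0 t_0)
  moreover have "gf w DH = 1 + A 1 + gf w ?H"
    by (subst by_height) (simp flip: A_def add: A_0)
  ultimately have "G = fps_const (1 - t 2) + fps_const (t 1 - t 2) * A 1 + fps_const (t 2) * gf w DH"
    by (simp add: algebra_simps flip: fps_const_sub)
  then have "z * G = z * fps_const (1 - t 2) + fps_const (t 1 - t 2) * (z * A 1) + z * fps_const (t 2) * gf w DH"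
    by (simp add: algebra_simps)
  then show ?thesis
    unfolding z_A_1 by (simp add: mult.commute)
qed

end

section \<open>Specialization to the four patterns\<close>

lemma weighted_DH_occurrences:
  "weighted_DH (\<lambda>P. fps_X ^ occurrences [a, U, b] P)
    (\<lambda>k. if a = U \<and> (if b = U then k \<ge> 2 else k = 1) then fps_X else 1)
    (\<lambda>k. if a = D \<and> (if b = U then k \<ge> 2 else k = 1) then fps_X else 1)"
proof
  fix \<alpha> \<beta> assume "\<alpha> \<in> DH" "\<beta> \<in> DH"
  moreover have "fps_X ^ (of_bool c + n) = (if c then fps_X else 1) * (fps_X ^ n :: rat fps)" for c n
    by (cases c) auto
  moreover have "take 2 P = [U, b] \<longleftrightarrow> (if b = U then ht P \<ge> 2 else ht P = 1)" if "P \<in> DH" for P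
    using take_2_DH[OF that] by (cases b) auto
  ultimately show "fps_X ^ occurrences [a, U, b] (U # \<alpha> @ D # \<beta>) =
    ((if a = U \<and> (if b = U then ht \<alpha> \<ge> 2 else ht \<alpha> = 1) then fps_X else 1) * fps_X ^ occurrences [a, U, b] \<alpha>) *
    ((if a = D \<and> (if b = U then ht \<beta> \<ge> 2 else ht \<beta> = 1) then fps_X else 1) * fps_X ^ occurrences [a, U, b] \<beta> :: rat fps)"
    by (simp only: occurrences_first_return power_add[of _ "_ + _" "_ + _"])
qed auto

lemma to_fract_eq_divideI: "d \<noteq> 0 \<Longrightarrow> f * d = n \<Longrightarrow> to_fract f = to_fract n / to_fract d"
  by (auto simp: divide_simps simp del: to_fract_mult simp flip: to_fract_mult)

text \<open>Here \<open>m\<close> is the value of \<open>M\<close> and the term added or subtracted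
  is \<open>2 * q * z\<close>, matching \<open>sqrt_discriminant\<close> with
  \<open>q = x * y\<close> and \<open>z = 1 - x\<close>.\<close>

lemma discriminant_factor_UUU:
  fixes x y :: "'a :: comm_ring_1"
  defines "m \<equiv> x^3 - x^3 * y + x^2 * y^2 - 2 * x + 1"
  shows "(x - x * y - 1) * (x^2 - x * y + x - 1)
      * (x^3 - x^3 * y + x^2 * y^2 + 2 * x^2 * y - 2 * x * y - 2 * x + 1)
    = (m - 2 * (x * y) * (1 - x)) * (m + 2 * (x * y) * (1 - x))"
  unfolding m_def by (simp add: algebra_simps power2_eq_square power3_eq_cube)

text \<open>Serves \<open>DUU\<close> as well, since \<open>q\<close>, \<open>z\<close> and
  \<open>M\<close> coincide for the two patterns.\<close>

lemma discriminant_factor_UUD: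
  fixes x y :: "'a :: comm_ring_1"
  defines "m \<equiv> 1 - 2 * x + 2 * x^2 - x^2 * y"
  shows "(x^2 * y - 1) * (x^2 * y - 4 * x^2 + 4 * x - 1)
    = (m - 2 * x * (1 - x)) * (m + 2 * x * (1 - x))"
  unfolding m_def by (simp add: algebra_simps power2_eq_square power3_eq_cube)

lemma discriminant_factor_DUD:
  fixes x y :: "'a :: comm_ring_1"
  defines "m \<equiv> (1 - x * y)^2 - x^3 * (1 - y)"
  shows "(x * y - x - 1) * (x^2 + y * x - x - 1)
      * (x^3 * y - x^3 + x^2 * y^2 + 2 * x^2 * y - 2 * x * y - 2 * x + 1)
    = (m - 2 * x * (1 - x * y)) * (m + 2 * x * (1 - x * y))"
  unfolding m_def by (simp add: algebra_simps power2_eq_square power3_eq_cube)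

lemma X_diff_nonzero: "X - 1 \<noteq> 0" "X * Y - 1 \<noteq> 0" "Y \<noteq> 0"
proof -
  show "X - 1 \<noteq> 0" "X * Y - 1 \<noteq> 0"
    by (auto dest: arg_cong[where f = "\<lambda>f. fps_nth f 0"])
qed auto

theorem theorem7:
  shows
    "(to_fract (F [U, U, U]) =
       to_fract (X^3 * Y - X^3 - X^2 * Y^2 + 2 * X - 1
         + fps2_sqrt ((X - X * Y - 1) * (X^2 - X * Y + X - 1)
             * (X^3 - X^3 * Y + X^2 * Y^2 + 2 * X^2 * Y - 2 * X * Y - 2 * X + 1)))
       / to_fract (2 * X^2 * Y^2 * (X - 1)))
  \<and> (to_fract (F [U, U, D]) =
       to_fract (X^2 * Y - 2 * X^2 + 2 * X - 1
         + fps2_sqrt ((X^2 * Y - 1) * (X^2 * Y - 4 * X^2 + 4 * X - 1)))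
       / to_fract (2 * X^2 * (X - 1)))
  \<and> (to_fract (F [D, U, U]) =
       to_fract (2 * X - X^2 * Y - 1
         + fps2_sqrt ((X^2 * Y - 1) * (X^2 * Y - 4 * X^2 + 4 * X - 1)))
       / to_fract (2 * X^2 * Y * (X - 1)))
  \<and> (to_fract (F [D, U, D]) =
       to_fract (X^3 * Y - X^3 - X^2 * Y^2 + 2 * X * Y - 1
         + fps2_sqrt ((X * Y - X - 1) * (X^2 + Y * X - X - 1)
             * (X^3 * Y - X^3 + X^2 * Y^2 + 2 * X^2 * Y - 2 * X * Y - 2 * X + 1)))
       / to_fract (2 * X^2 * (X * Y - 1)))"
proof (intro conjI)
  interpret UUU: weighted_DH "\<lambda>P. fps_X ^ occurrences [U, U, U] P" "\<lambda>k. if k \<ge> 2 then fps_X else 1" "\<lambda>k. 1"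
    using weighted_DH_occurrences[of U U] by simp
  interpret UUD: weighted_DH "\<lambda>P. fps_X ^ occurrences [U, U, D] P" "\<lambda>k. if k = Suc 0 then fps_X else 1" "\<lambda>k. 1"
    using weighted_DH_occurrences[of U D] by simp
  interpret DUU: weighted_DH "\<lambda>P. fps_X ^ occurrences [D, U, U] P" "\<lambda>k. 1" "\<lambda>k. if k \<ge> 2 then fps_X else 1"
    using weighted_DH_occurrences[of D U] by simp
  interpret DUD: weighted_DH "\<lambda>P. fps_X ^ occurrences [D, U, D] P" "\<lambda>k. 1" "\<lambda>k. if k = Suc 0 then fps_X else 1"
    using weighted_DH_occurrences[of D D] by simp

  have z: "UUU.z = 1 - X" "UUD.z = 1 - X" "DUU.z = 1 - X" "DUD.z = 1 - X * Y"
    by (simp_all add: UUU.z_def UUD.z_def DUU.z_def DUD.z_def)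
  have q: "UUU.q = X * Y" "UUD.q = X" "DUU.q = X" "DUD.q = X"
    by (simp_all add: UUU.q_def UUD.q_def DUU.q_def DUD.q_def)
  have M: "UUU.M = X^3 - X^3 * Y + X^2 * Y^2 - 2 * X + 1" "UUD.M = 1 - 2 * X + 2 * X^2 - X^2 * Y"
    "DUU.M = 1 - 2 * X + 2 * X^2 - X^2 * Y" "DUD.M = (1 - X * Y)^2 - X^3 * (1 - Y)"
    by (simp_all add: UUU.M_def UUD.M_def DUU.M_def DUD.M_def z q
        algebra_simps power2_eq_square power3_eq_cube)
  \<comment> \<open>For patterns starting with \<open>U\<close> the tail weights are 1, so
    \<open>G\<close> is \<open>F\<close>. For \<open>DUU\<close> the extra terms
    \<open>(1 - X) * (1 - Y)\<close> and \<open>X * (1 - Y)\<close> add up to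
    \<open>1 - Y\<close>.\<close>
  have G: "(1 - X) * UUU.G = (1 - X) * F [U, U, U]" "(1 - X) * UUD.G = (1 - X) * F [U, U, D]"
    "(1 - X) * DUU.G = 1 - Y + (1 - X) * Y * F [D, U, U]"
    "(1 - X * Y) * DUD.G = X * (Y - 1) + (1 - X * Y) * F [D, U, D]"
    using UUU.z_G UUD.z_G DUU.z_G DUD.z_G
    by (simp_all add: z F_eq_gf algebra_simps flip: fps_const_sub)

  show "to_fract (F [U, U, U]) =
       to_fract (X^3 * Y - X^3 - X^2 * Y^2 + 2 * X - 1
         + fps2_sqrt ((X - X * Y - 1) * (X^2 - X * Y + X - 1)
             * (X^3 - X^3 * Y + X^2 * Y^2 + 2 * X^2 * Y - 2 * X * Y - 2 * X + 1)))
       / to_fract (2 * X^2 * Y^2 * (X - 1))"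
  proof (rule to_fract_eq_divideI)
    have "fps2_sqrt ((X - X * Y - 1) * (X^2 - X * Y + X - 1)
        * (X^3 - X^3 * Y + X^2 * Y^2 + 2 * X^2 * Y - 2 * X * Y - 2 * X + 1))
      = UUU.M - 2 * (X * Y)\<^sup>2 * ((1 - X) * F [U, U, U])"
      using UUU.sqrt_discriminant by (simp only: discriminant_factor_UUU z G M q)
    then show "F [U, U, U] * (2 * X^2 * Y^2 * (X - 1)) = X^3 * Y - X^3 - X^2 * Y^2 + 2 * X - 1
        + fps2_sqrt ((X - X * Y - 1) * (X^2 - X * Y + X - 1)
             * (X^3 - X^3 * Y + X^2 * Y^2 + 2 * X^2 * Y - 2 * X * Y - 2 * X + 1))"
      unfolding M by (simp add: algebra_simps power2_eq_square power3_eq_cube)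
  qed (simp add: X_diff_nonzero)

  show "to_fract (F [U, U, D]) =
       to_fract (X^2 * Y - 2 * X^2 + 2 * X - 1
         + fps2_sqrt ((X^2 * Y - 1) * (X^2 * Y - 4 * X^2 + 4 * X - 1)))
       / to_fract (2 * X^2 * (X - 1))"
  proof (rule to_fract_eq_divideI)
    have "fps2_sqrt ((X^2 * Y - 1) * (X^2 * Y - 4 * X^2 + 4 * X - 1))
      = UUD.M - 2 * X\<^sup>2 * ((1 - X) * F [U, U, D])"
      using UUD.sqrt_discriminant by (simp only: discriminant_factor_UUD z G M q)
    then show "F [U, U, D] * (2 * X^2 * (X - 1)) = X^2 * Y - 2 * X^2 + 2 * X - 1
        + fps2_sqrt ((X^2 * Y - 1) * (X^2 * Y - 4 * X^2 + 4 * X - 1))"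
      unfolding M by (simp add: algebra_simps power2_eq_square power3_eq_cube)
  qed (simp add: X_diff_nonzero)

  show "to_fract (F [D, U, U]) =
       to_fract (2 * X - X^2 * Y - 1
         + fps2_sqrt ((X^2 * Y - 1) * (X^2 * Y - 4 * X^2 + 4 * X - 1)))
       / to_fract (2 * X^2 * Y * (X - 1))"
  proof (rule to_fract_eq_divideI)
    have "fps2_sqrt ((X^2 * Y - 1) * (X^2 * Y - 4 * X^2 + 4 * X - 1))
      = DUU.M - 2 * X\<^sup>2 * (1 - Y + (1 - X) * Y * F [D, U, U])"
      using DUU.sqrt_discriminant by (simp only: discriminant_factor_UUD z G M q)
    then show "F [D, U, U] * (2 * X^2 * Y * (X - 1)) = 2 * X - X^2 * Y - 1
        + fps2_sqrt ((X^2 * Y - 1) * (X^2 * Y - 4 * X^2 + 4 * X - 1))"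
      unfolding M by (simp add: algebra_simps power2_eq_square power3_eq_cube)
  qed (simp add: X_diff_nonzero)

  show "to_fract (F [D, U, D]) =
       to_fract (X^3 * Y - X^3 - X^2 * Y^2 + 2 * X * Y - 1
         + fps2_sqrt ((X * Y - X - 1) * (X^2 + Y * X - X - 1)
             * (X^3 * Y - X^3 + X^2 * Y^2 + 2 * X^2 * Y - 2 * X * Y - 2 * X + 1)))
       / to_fract (2 * X^2 * (X * Y - 1))"
  proof (rule to_fract_eq_divideI)
    have "fps2_sqrt ((X * Y - X - 1) * (X^2 + Y * X - X - 1)
        * (X^3 * Y - X^3 + X^2 * Y^2 + 2 * X^2 * Y - 2 * X * Y - 2 * X + 1))
      = DUD.M - 2 * X\<^sup>2 * (X * (Y - 1) + (1 - X * Y) * F [D, U, D])"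
      using DUD.sqrt_discriminant by (simp only: discriminant_factor_DUD z G M q)
    then show "F [D, U, D] * (2 * X^2 * (X * Y - 1)) = X^3 * Y - X^3 - X^2 * Y^2 + 2 * X * Y - 1
        + fps2_sqrt ((X * Y - X - 1) * (X^2 + Y * X - X - 1)
             * (X^3 * Y - X^3 + X^2 * Y^2 + 2 * X^2 * Y - 2 * X * Y - 2 * X + 1))"
      unfolding M by (simp add: algebra_simps power2_eq_square power3_eq_cube)
  qed (simp add: X_diff_nonzero)
qed

end
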